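(* For every $(x,y)\in\mathbb{Z}\times[0,\infty)$ it holds that $J(x,y)=J_{\pi^*}(x,y)$, where $\pi^*$ is the policy generated by $f^*$ with initial value $y_0=y$.
   Context: Setting. $X=\mathbb{Z}$, $\beta\in(0,1)$ is a discount factor, $Z_1,Z_2,\ldots$ are i.i.d. integer-valued random variables with $\mathbb{P}(Z_n=k)=q_k$, $k\in\mathbb{Z}$; $Z$ denotes a generic copy. Standing assumptions: $\mathbb{E}Z^+<\infty$ (where $Z^+=\max\{Z,0\}$) and $\mathbb{P}(Z<0)>0$. Action sets: $A(x)=\{0,\ldots,x\}$ for $x\ge0$ and $A(x)=\{0\}$ for $x<0$; $D=\{(x,a):x\in X,a\in A(x)\}$. A policy $\pi=(\pi_k)_{k\ge0}$ is a sequence of maps assigning to each history $(x_0,a_0,\ldots,x_{k-1},a_{k-1},x_k)$ with $(x_m,a_m)\in D$ an action in $A(x_k)$; $\Pi$ is the set of all policies. Under $\pi$ and $x_0=x$, $a_k=\pi_k(x_0,a_0,\ldots,x_k)$, and $x_{k+1}=x_k-a_k+Z_{k+1}$ if $x_k\ge0$, $x_{k+1}=x_k$ if $x_k<0$; expectation is $\mathbb{E}_x^\pi$. The ruin time $\tau$ is the smallest $n\in\mathbb{N}_0$ with $x_n<0$ ($\tau=\infty$ if there is none). Fix $\gamma\in(0,1)$. For $x\in X$, $y\ge0$, $$J_\pi(x,y)=\mathbb{E}_x^\pi\Big(\sum_{k=0}^{\tau-1}\beta^k a_k+y\Big)^\gamma,\qquad J(x,y)=\sup_{\pi\in\Pi}J_\pi(x,y),$$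 empty sums being $0$; thus $J(x,y)=y^\gamma$ for $x<0$. For $x\in\mathbb{N}_0$, $y\ge0$ let $G(x,y)=\sum_{k=-\infty}^\infty J(x+k,y)q_k$. For $x\ge0$, $f^*(x,y)$ is the largest maximiser over $a\in A(x)$ of $a\mapsto\beta^\gamma G(x-a,\frac{a+y}{\beta})$; for $x<0$, $f^*(x,y)=0$. The policy $\pi^*=(\pi_k^* )_{k\ge0}$ generated by $f^*$ with fixed initial value $y_0\ge0$ is $\pi^*_k(x_0,a_0,\ldots,x_k)=f^*(x_k,y_k)$, where $y_k=\frac{y_{k-1}+f^*(x_{k-1},y_{k-1})}{\beta}$ for $k\ge1$. *)

theory Defs
  imports "HOL-Probability.Probability"
begin

definition A :: "int \<Rightarrow> int set" where
  "A x = (if x \<ge> 0 then {0..x} else {0})"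

definition D :: "(int \<times> int) set" where
  "D = {(x, a). a \<in> A x}"

text \<open>The history \<open>(x\<^sub>0, a\<^sub>0, \<dots>, x\<^sub>k\<^sub>-\<^sub>1, a\<^sub>k\<^sub>-\<^sub>1, x\<^sub>k)\<close> is encoded as the list
  \<open>[(x\<^sub>0, a\<^sub>0), \<dots>, (x\<^sub>k\<^sub>-\<^sub>1, a\<^sub>k\<^sub>-\<^sub>1)]\<close> together with the current state \<open>x\<^sub>k\<close>. All histories live in
  countable sets, so no measurability condition is needed.\<close>

type_synonym policy = "nat \<Rightarrow> (int \<times> int) list \<Rightarrow> int \<Rightarrow> int"

definition policies :: "policy set" where
  "policies = {\<pi>. \<forall>k h x. length h = k \<longrightarrow> set h \<subseteq> D \<longrightarrow> \<pi> k h x \<in> A x}"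

text \<open>For a realisation \<open>z\<close> of the increments, \<open>run \<pi> x z k\<close> is the pair of the list
  \<open>[(x\<^sub>0, a\<^sub>0), \<dots>, (x\<^sub>k\<^sub>-\<^sub>1, a\<^sub>k\<^sub>-\<^sub>1)]\<close> and the state \<open>x\<^sub>k\<close>; only \<open>z 1, z 2, \<dots>\<close> are used.\<close>

primrec run :: "policy \<Rightarrow> int \<Rightarrow> (nat \<Rightarrow> int) \<Rightarrow> nat \<Rightarrow> (int \<times> int) list \<times> int" where
  "run \<pi> x z 0 = ([], x)"
| "run \<pi> x z (Suc k) =
    (let (h, s) = run \<pi> x z k; a = \<pi> k h s
     in (h @ [(s, a)], if s \<ge> 0 then s - a + z (Suc k) else s))"

definition state :: "policy \<Rightarrow> int \<Rightarrow> (nat \<Rightarrow> int) \<Rightarrow> nat \<Rightarrow> int" where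
  "state \<pi> x z k = snd (run \<pi> x z k)"

definition action :: "policy \<Rightarrow> int \<Rightarrow> (nat \<Rightarrow> int) \<Rightarrow> nat \<Rightarrow> int" where
  "action \<pi> x z k = \<pi> k (fst (run \<pi> x z k)) (state \<pi> x z k)"

definition ruin_time :: "policy \<Rightarrow> int \<Rightarrow> (nat \<Rightarrow> int) \<Rightarrow> enat" where
  "ruin_time \<pi> x z = Inf (enat ` {n. state \<pi> x z n < 0})"

text \<open>Payoffs and expectations take values in \<open>[0, \<infinity>]\<close>, so that the infinite sum, the expectation
  and the supremum all exist without side conditions.\<close>

definition ennreal_power :: "ennreal \<Rightarrow> real \<Rightarrow> ennreal" where
  "ennreal_power t \<gamma> = (if t = \<infinity> then \<infinity> else ennreal (enn2real t powr \<gamma>))"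

definition dividends :: "real \<Rightarrow> policy \<Rightarrow> int \<Rightarrow> (nat \<Rightarrow> int) \<Rightarrow> ennreal" where
  "dividends \<beta> \<pi> x z =
    (\<Sum>k. if enat k < ruin_time \<pi> x z then ennreal (\<beta> ^ k * real_of_int (action \<pi> x z k)) else 0)"

definition J_policy ::
  "'w measure \<Rightarrow> (nat \<Rightarrow> 'w \<Rightarrow> int) \<Rightarrow> real \<Rightarrow> real \<Rightarrow> policy \<Rightarrow> int \<Rightarrow> real \<Rightarrow> ennreal" where
  "J_policy M Z \<beta> \<gamma> \<pi> x y =
    (\<integral>\<^sup>+ \<omega>. ennreal_power (dividends \<beta> \<pi> x (\<lambda>n. Z n \<omega>) + ennreal y) \<gamma> \<partial>M)"

definition J ::
  "'w measure \<Rightarrow> (nat \<Rightarrow> 'w \<Rightarrow> int) \<Rightarrow> real \<Rightarrow> real \<Rightarrow> int \<Rightarrow> real \<Rightarrow> ennreal" where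
  "J M Z \<beta> \<gamma> x y = (SUP \<pi>\<in>policies. J_policy M Z \<beta> \<gamma> \<pi> x y)"

definition G ::
  "'w measure \<Rightarrow> (nat \<Rightarrow> 'w \<Rightarrow> int) \<Rightarrow> (int \<Rightarrow> real) \<Rightarrow> real \<Rightarrow> real \<Rightarrow> int \<Rightarrow> real \<Rightarrow> ennreal" where
  "G M Z q \<beta> \<gamma> x y = (\<Sum>\<^sub>\<infinity>k\<in>UNIV. J M Z \<beta> \<gamma> (x + k) y * ennreal (q k))"

definition fstar ::
  "'w measure \<Rightarrow> (nat \<Rightarrow> 'w \<Rightarrow> int) \<Rightarrow> (int \<Rightarrow> real) \<Rightarrow> real \<Rightarrow> real \<Rightarrow> int \<Rightarrow> real \<Rightarrow> int" where
  "fstar M Z q \<beta> \<gamma> x y =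
    (if x \<ge> 0 then
       (let v = (\<lambda>a. ennreal (\<beta> powr \<gamma>) * G M Z q \<beta> \<gamma> (x - a) ((real_of_int a + y) / \<beta>))
        in Max {a \<in> A x. \<forall>b\<in>A x. v b \<le> v a})
     else 0)"

text \<open>The fold computes \<open>y\<^sub>k\<close> from \<open>y\<^sub>0\<close> and the states recorded in the history; the recorded
  actions are not used.\<close>

definition pistar ::
  "'w measure \<Rightarrow> (nat \<Rightarrow> 'w \<Rightarrow> int) \<Rightarrow> (int \<Rightarrow> real) \<Rightarrow> real \<Rightarrow> real \<Rightarrow> real \<Rightarrow> policy" where
  "pistar M Z q \<beta> \<gamma> y0 = (\<lambda>k h x.
     fstar M Z q \<beta> \<gamma> x
       (foldl (\<lambda>y (s, a). (y + real_of_int (fstar M Z q \<beta> \<gamma> s y)) / \<beta>) y0 h))"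

lemma fstar_in_A: "fstar M Z q \<beta> \<gamma> x y \<in> A x"
proof (cases "x \<ge> 0")
  case True
  define v where "v = (\<lambda>a. ennreal (\<beta> powr \<gamma>) * G M Z q \<beta> \<gamma> (x - a) ((real_of_int a + y) / \<beta>))"
  define S where "S = {a \<in> A x. \<forall>b\<in>A x. v b \<le> v a}"
  have fin: "finite (A x)" and ne: "A x \<noteq> {}"
    using True by (auto simp: A_def)
  have "Max (v ` A x) \<in> v ` A x"
    using fin ne by (intro Max_in) auto
  then obtain a where a: "a \<in> A x" "v a = Max (v ` A x)" by auto
  have "v b \<le> v a" if "b \<in> A x" for b
    using that fin a(2) by simp
  then have "a \<in> S" using a(1) by (auto simp: S_def)
  then have "Max S \<in> S"
    using fin by (intro Max_in) (auto simp: S_def)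
  then show ?thesis
    using True by (simp add: fstar_def Let_def v_def S_def)
qed (simp add: fstar_def A_def)

lemma pistar_in_policies: "pistar M Z q \<beta> \<gamma> y0 \<in> policies"
  by (simp add: policies_def pistar_def fstar_in_A)

end

theory Submission
  imports Defs
begin

text \<open>
  Write \<open>V\<close> for the best value \<open>J\<close> and \<open>V\<^sup>*(x,y)\<close> for the value of the policy
  generated by \<open>f\<^sup>*\<close> from the initial value \<open>y\<close>. Only \<open>V \<le> V\<^sup>*\<close> needs an argument. Paying \<open>a\<close> in
  state \<open>x \<ge> 0\<close> turns the total payoff \<open>a + \<beta> S + y\<close> into \<open>\<beta> (S + (a + y) / \<beta>)\<close>, where \<open>S\<close>
  is the payoff of the remaining problem. The power utility is homogeneous, so the value of every
  policy is \<open>\<beta>\<^sup>\<gamma>\<close> times the expected value of its continuation, started in \<open>x - a + Z\<close> with the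
  accumulated payoff \<open>(a + y) / \<beta>\<close> (\<open>value_of_first_step\<close>). Two consequences are used.

  \<^item> Each continuation is worth at most \<open>V\<close>, and \<open>f\<^sup>*\<close> maximises the expected
    value, so \<open>V(x,y) \<le> \<beta>\<^sup>\<gamma> E V(x - a + Z, (a + y) / \<beta>)\<close> for \<open>a = f\<^sup>*(x,y)\<close>
    (\<open>best_value_le_greedy\<close>).

  \<^item> The continuation of the generated policy is again a generated policy, with the initial value
    updated to \<open>(a + y) / \<beta>\<close>. Hence \<open>V\<^sup>*\<close> satisfies the same relation with equality
    (\<open>greedy_policy_first_step\<close>).

  Thus the excess of \<open>V\<close> over \<open>V\<^sup>*\<close> is at most \<open>\<beta>\<^sup>\<gamma>\<close> times its expectation after one step, where
  \<open>\<beta>\<^sup>\<gamma> < 1\<close>, and this can be iterated. A first bound on the excess is affine in the surplus: by subadditivity of the power,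
  \<open>V(x,y) - y\<^sup>\<gamma>\<close> is at most \<open>1\<close> plus the largest expected discounted dividends, and since dividends
  are financed by the initial surplus and the positive parts of the increments, these are at
  most affine in \<open>max x 0\<close> (\<open>best_value_le_linear\<close>). One step raises the expected positive part of the
  surplus by at most \<open>E Z\<^sup>+\<close>, so after \<open>n\<close> steps the excess is at most \<open>(\<beta>\<^sup>\<gamma>)\<^sup>n\<close> times a quantity
  affine in \<open>n\<close>, called \<open>gap n x\<close> below, which tends to \<open>0\<close>.
\<close>

section \<open>The power utility on extended payoffs\<close>

lemma ennreal_power_ennreal: "0 \<le> t \<Longrightarrow> ennreal_power (ennreal t) \<gamma> = ennreal (t powr \<gamma>)"
  by (simp add: ennreal_power_def)

lemma ennreal_power_mono:
  assumes "s \<le> t" "0 \<le> \<gamma>"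
  shows "ennreal_power s \<gamma> \<le> ennreal_power t \<gamma>"
proof (cases "t = \<infinity>")
  case False
  then obtain b where b: "t = ennreal b" "0 \<le> b" by (cases t) auto
  with assms obtain a where a: "s = ennreal a" "0 \<le> a" by (cases s) (auto simp: top_unique)
  show ?thesis using a b assms by (simp add: ennreal_power_ennreal powr_mono2)
qed (simp add: ennreal_power_def)

lemma ennreal_power_cmult:
  assumes "0 < c"
  shows "ennreal_power (ennreal c * t) \<gamma> = ennreal (c powr \<gamma>) * ennreal_power t \<gamma>"
proof (cases t)
  case (real r)
  then show ?thesis using assms
    by (simp add: ennreal_power_ennreal ennreal_mult[symmetric] powr_mult)
next
  case top
  then show ?thesis using assms by (simp add: ennreal_power_def ennreal_mult_top)
qed

text \<open>For \<open>s + y > 1\<close> the factor \<open>(s + y) powr (\<gamma> - 1)\<close> is at most \<open>1\<close> and at most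
  \<open>y powr (\<gamma> - 1)\<close>; otherwise the left side is at most \<open>1\<close>. The bound is affine in \<open>s\<close>, so that
  expected utilities can be estimated by expected dividends.\<close>

lemma ennreal_power_add_le:
  assumes "0 < \<gamma>" "\<gamma> < 1" "0 \<le> y"
  shows "ennreal_power (s + ennreal y) \<gamma> \<le> 1 + s + ennreal (y powr \<gamma>)"
proof (cases s)
  case (real r)
  have "(r + y) powr \<gamma> \<le> 1 + r + y powr \<gamma>"
  proof (cases "r + y \<le> 1")
    case True
    then have "(r + y) powr \<gamma> \<le> 1" using real assms by (intro powr_le1) auto
    then show ?thesis using real by (smt (verit) powr_ge_zero)
  next
    case False
    have "(r + y) powr \<gamma> = (r + y) * (r + y) powr (\<gamma> - 1)"
      using False by (simp add: powr_diff)
    then have split: "(r + y) powr \<gamma> = r * (r + y) powr (\<gamma> - 1) + y * (r + y) powr (\<gamma> - 1)"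
      by (simp add: distrib_right)
    (* the exponent is negative and the base exceeds 1 *)
    have "(r + y) powr (\<gamma> - 1) \<le> 1"
      using False assms by (smt (verit) powr_mono2' powr_one_eq_one)
    then have 1: "r * (r + y) powr (\<gamma> - 1) \<le> r"
      using real by (simp add: mult_left_le)
    have 2: "y * (r + y) powr (\<gamma> - 1) \<le> y powr \<gamma>"
    proof (cases "y = 0")
      case False
      then have y: "0 < y" using assms by simp
      have "y * (r + y) powr (\<gamma> - 1) \<le> y * y powr (\<gamma> - 1)"
        using y real assms by (intro mult_left_mono powr_mono2') auto
      also have "\<dots> = y powr \<gamma>" using y by (simp add: powr_diff)
      finally show ?thesis .
    qed simp
    show ?thesis using split 1 2 by linarith
  qed
  then show ?thesis using real assms
    by (simp add: ennreal_power_ennreal ennreal_plus[symmetric] ennreal_1[symmetric]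
        del: ennreal_plus ennreal_1)
qed simp

lemma measurable_ennreal_power: "(\<lambda>t. ennreal_power t \<gamma>) \<in> borel_measurable borel"
  unfolding ennreal_power_def by measurable

section \<open>Trajectories and discounted dividends\<close>

lemma less_ruin_time_iff: "enat k < ruin_time \<pi> x z \<longleftrightarrow> (\<forall>j\<le>k. 0 \<le> state \<pi> x z j)"
proof
  assume k: "enat k < ruin_time \<pi> x z"
  show "\<forall>j\<le>k. 0 \<le> state \<pi> x z j"
  proof (intro allI impI, rule ccontr)
    fix j assume j: "j \<le> k" "\<not> 0 \<le> state \<pi> x z j"
    then have "ruin_time \<pi> x z \<le> enat j"
      unfolding ruin_time_def by (intro Inf_lower) auto
    with j k show False by (meson enat_ord_simps(1) leD order_trans)
  qed
next
  assume all: "\<forall>j\<le>k. 0 \<le> state \<pi> x z j"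
  define S where "S = enat ` {n. state \<pi> x z n < 0}"
  show "enat k < ruin_time \<pi> x z"
  proof (cases "S = {}")
    case True
    then show ?thesis by (simp add: ruin_time_def S_def Inf_enat_def)
  next
    case False
    then have "Inf S \<in> S" unfolding Inf_enat_def by (auto intro: LeastI)
    then obtain n where "Inf S = enat n" "state \<pi> x z n < 0" by (auto simp: S_def)
    with all show ?thesis by (auto simp: ruin_time_def S_def not_le[symmetric])
  qed
qed

lemma run_cong: "(\<And>n. n \<ge> 1 \<Longrightarrow> z n = z' n) \<Longrightarrow> run \<pi> x z k = run \<pi> x z' k"
  by (induction k) (auto simp: Let_def split: prod.splits)

lemma dividends_cong:
  assumes "\<And>n. n \<ge> 1 \<Longrightarrow> z n = z' n"
  shows "dividends \<beta> \<pi> x z = dividends \<beta> \<pi> x z'"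
proof -
  have "run \<pi> x z = run \<pi> x z'" using run_cong[OF assms] by (rule ext)
  then show ?thesis unfolding dividends_def ruin_time_def state_def action_def by (simp only:)
qed

text \<open>The policy that remains to be played once the first state-action pair \<open>p\<close> has been
  recorded; it has to carry \<open>p\<close> along because policies may depend on the whole history.\<close>

definition continuation :: "policy \<Rightarrow> int \<times> int \<Rightarrow> policy" where
  "continuation \<pi> p = (\<lambda>k h. \<pi> (Suc k) (p # h))"

lemma policy_action_in_A: "\<pi> \<in> policies \<Longrightarrow> set h \<subseteq> D \<Longrightarrow> \<pi> (length h) h x \<in> A x"
  unfolding policies_def by blast

lemma continuation_in_policies:
  assumes "\<pi> \<in> policies" "p \<in> D"
  shows "continuation \<pi> p \<in> policies"
proof -
  have "\<pi> (Suc (length h)) (p # h) x \<in> A x" if "set h \<subseteq> D" for h x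
    using policy_action_in_A[OF assms(1), of "p # h" x] that assms(2) by simp
  then show ?thesis by (auto simp: policies_def continuation_def)
qed

text \<open>The recursion of \<open>run\<close> peels off the last step, the Bellman argument the first one;
  this connects the two.\<close>

lemma run_Suc_continuation:
  assumes "0 \<le> x" "a = \<pi> 0 [] x"
    and "run (continuation \<pi> (x, a)) (x - a + z 1) (\<lambda>n. z (Suc n)) k = (h, s)"
  shows "run \<pi> x z (Suc k) = ((x, a) # h, s)"
  using assms(3)
proof (induction k arbitrary: h s)
  case 0
  then show ?case using assms(1,2) by simp
next
  case (Suc k)
  obtain h' s' where
    step: "run (continuation \<pi> (x, a)) (x - a + z 1) (\<lambda>n. z (Suc n)) k = (h', s')" by fastforce
  have "run \<pi> x z (Suc (Suc k)) =
      (let b = \<pi> (Suc k) ((x, a) # h') s'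
       in (((x, a) # h') @ [(s', b)], if s' \<ge> 0 then s' - b + z (Suc (Suc k)) else s'))"
    by (subst run.simps(2), subst Suc.IH[OF step]) simp
  moreover have "(h, s) =
      (let b = \<pi> (Suc k) ((x, a) # h') s'
       in (h' @ [(s', b)], if s' \<ge> 0 then s' - b + z (Suc (Suc k)) else s'))"
    using Suc.prems step by (simp add: continuation_def)
  ultimately show ?case by (simp add: Let_def)
qed

lemma dividends_first_step:
  assumes "0 < \<beta>" "0 \<le> x" "a = \<pi> 0 [] x"
  shows "dividends \<beta> \<pi> x z = ennreal (real_of_int a)
    + ennreal \<beta> * dividends \<beta> (continuation \<pi> (x, a)) (x - a + z 1) (\<lambda>n. z (Suc n))"
proof -
  let ?\<pi> = "continuation \<pi> (x, a)" and ?x = "x - a + z 1" and ?z = "\<lambda>n. z (Suc n)"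
  have st: "state \<pi> x z (Suc k) = state ?\<pi> ?x ?z k"
    and ac: "action \<pi> x z (Suc k) = action ?\<pi> ?x ?z k" for k
  proof -
    obtain h s where hs: "run ?\<pi> ?x ?z k = (h, s)" by fastforce
    note hs' = run_Suc_continuation[OF assms(2,3) hs]
    show "state \<pi> x z (Suc k) = state ?\<pi> ?x ?z k"
      unfolding state_def hs hs' by simp
    show "action \<pi> x z (Suc k) = action ?\<pi> ?x ?z k"
      unfolding action_def state_def hs hs' by (simp add: continuation_def)
  qed
  have all: "(\<forall>j\<le>Suc k. 0 \<le> state \<pi> x z j) \<longleftrightarrow> (\<forall>j\<le>k. 0 \<le> state ?\<pi> ?x ?z j)" for k
  proof -
    have 0: "0 \<le> state \<pi> x z 0" using assms by (simp add: state_def)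
    show ?thesis
    proof
      assume l: "\<forall>j\<le>Suc k. 0 \<le> state \<pi> x z j"
      show "\<forall>j\<le>k. 0 \<le> state ?\<pi> ?x ?z j"
      proof (intro allI impI)
        fix j assume "j \<le> k"
        then show "0 \<le> state ?\<pi> ?x ?z j" unfolding st[symmetric] using l by blast
      qed
    next
      assume r: "\<forall>j\<le>k. 0 \<le> state ?\<pi> ?x ?z j"
      show "\<forall>j\<le>Suc k. 0 \<le> state \<pi> x z j"
      proof (intro allI impI)
        fix j assume "j \<le> Suc k"
        then show "0 \<le> state \<pi> x z j"
          using 0 r by (cases j) (simp_all only: st Suc_le_mono)
      qed
    qed
  qed
  define f where "f k = (if enat k < ruin_time \<pi> x z
     then ennreal (\<beta> ^ k * real_of_int (action \<pi> x z k)) else 0)" for k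
  define g where "g k = (if enat k < ruin_time ?\<pi> ?x ?z
     then ennreal (\<beta> ^ k * real_of_int (action ?\<pi> ?x ?z k)) else 0)" for k
  have fS: "f (Suc k) = ennreal \<beta> * g k" for k
    unfolding f_def g_def less_ruin_time_iff all ac
    using assms(1) by (simp only: if_distrib[of "(*) (ennreal \<beta>)"] power_Suc mult.assoc
        ennreal_mult' less_imp_le mult_zero_right)
  have f0: "f 0 = ennreal (real_of_int a)"
    using assms by (simp add: f_def less_ruin_time_iff state_def action_def)
  have "suminf f = f 0 + (\<Sum>k. f (Suc k))"
    using suminf_offset[of f 1] by (simp add: add.commute)
  also have "(\<Sum>k. f (Suc k)) = ennreal \<beta> * suminf g"
    by (simp add: fS)
  finally show ?thesis unfolding f0 unfolding f_def g_def dividends_def .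
qed

lemma dividends_ruined:
  assumes "x < 0"
  shows "dividends \<beta> \<pi> x z = 0"
proof -
  have "state \<pi> x z 0 < 0" using assms by (simp add: state_def)
  then have "\<not> enat k < ruin_time \<pi> x z" for k
    unfolding less_ruin_time_iff by (meson le0 not_le)
  then show ?thesis by (simp add: dividends_def)
qed

lemma run_history_in_D:
  assumes "\<pi> \<in> policies"
  shows "length (fst (run \<pi> x z k)) = k \<and> set (fst (run \<pi> x z k)) \<subseteq> D"
proof (induction k)
  case (Suc k)
  obtain h s where hs: "run \<pi> x z k = (h, s)" by fastforce
  with Suc policy_action_in_A[OF assms, of h s] show ?case
    by (simp add: Let_def D_def)
qed simp

lemma action_in_A:
  assumes "\<pi> \<in> policies"
  shows "action \<pi> x z k \<in> A (state \<pi> x z k)"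
  using policy_action_in_A[OF assms, of "fst (run \<pi> x z k)" "state \<pi> x z k"]
    run_history_in_D[OF assms, of x z k] by (simp only: action_def)

lemma state_Suc:
  "state \<pi> x z (Suc k) =
    (if 0 \<le> state \<pi> x z k then state \<pi> x z k - action \<pi> x z k + z (Suc k) else state \<pi> x z k)"
  by (simp add: state_def action_def Let_def split: prod.splits)

text \<open>Dividends are nonnegative, so the surplus never exceeds the initial surplus plus all
  gains so far. The maximum with \<open>0\<close> makes the bound nonnegative for ruined states as well.\<close>

lemma state_le_total_income:
  assumes "\<pi> \<in> policies"
  shows "state \<pi> x z k \<le> max x 0 + (\<Sum>i=1..k. max (z i) 0)"
proof (induction k)
  case (Suc k)
  have "0 \<le> state \<pi> x z k \<Longrightarrow> 0 \<le> action \<pi> x z k"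
    using action_in_A[OF assms, of x z k] by (simp add: A_def)
  moreover have "(\<Sum>i=1..Suc k. max (z i) 0) = (\<Sum>i=1..k. max (z i) 0) + max (z (Suc k)) 0"
    by simp
  ultimately show ?case using Suc unfolding state_Suc by (smt (verit))
qed (simp add: state_def)

text \<open>Each dividend is at most the current surplus. Bounding it by the total income up to that
  time counts income repeatedly, but the discounting still keeps the expectation of the sum finite.\<close>

lemma dividends_le_discounted_income:
  assumes "\<pi> \<in> policies" "0 < \<beta>"
  shows "dividends \<beta> \<pi> x z
    \<le> (\<Sum>k. ennreal (\<beta> ^ k) * (ennreal (real_of_int (max x 0))
          + (\<Sum>i=1..k. ennreal (real_of_int (max (z i) 0)))))"
  unfolding dividends_def
proof (intro suminf_le allI)
  fix k
  have "action \<pi> x z k \<le> max x 0 + (\<Sum>i=1..k. max (z i) 0)" if "0 \<le> state \<pi> x z k"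
    using that action_in_A[OF assms(1), of x z k] state_le_total_income[OF assms(1), of x z k]
    by (auto simp: A_def)
  then have "real_of_int (action \<pi> x z k)
      \<le> real_of_int (max x 0) + (\<Sum>i=1..k. real_of_int (max (z i) 0))" if "0 \<le> state \<pi> x z k"
    using that by (metis of_int_add of_int_le_iff of_int_sum)
  then have "ennreal (\<beta> ^ k * real_of_int (action \<pi> x z k))
    \<le> ennreal (\<beta> ^ k * (real_of_int (max x 0) + (\<Sum>i=1..k. real_of_int (max (z i) 0))))"
    if "0 \<le> state \<pi> x z k"
    using that assms by (intro ennreal_leI mult_left_mono) auto
  also have "ennreal (\<beta> ^ k * (real_of_int (max x 0) + (\<Sum>i=1..k. real_of_int (max (z i) 0))))
    = ennreal (\<beta> ^ k) * (ennreal (real_of_int (max x 0))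
          + (\<Sum>i=1..k. ennreal (real_of_int (max (z i) 0))))"
    using assms by (simp add: ennreal_mult sum_nonneg ennreal_plus sum_ennreal)
  finally show "(if enat k < ruin_time \<pi> x z
      then ennreal (\<beta> ^ k * real_of_int (action \<pi> x z k)) else 0)
    \<le> ennreal (\<beta> ^ k) * (ennreal (real_of_int (max x 0))
          + (\<Sum>i=1..k. ennreal (real_of_int (max (z i) 0))))"
    by (auto simp: less_ruin_time_iff)
qed simp_all

text \<open>Every function of a finite history is measurable because histories live in a countable
  set. The dynamics read the increments from index \<open>1\<close> on, whereas the coordinates of the sequence space start
  at \<open>0\<close>; this is the reason for the index \<open>n - 1\<close> here and below.\<close>

lemma measurable_run:
  "(\<lambda>\<zeta>. run \<pi> x (\<lambda>n. \<zeta> (n - 1)) k)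
     \<in> (\<Pi>\<^sub>M i\<in>UNIV::nat set. count_space UNIV) \<rightarrow>\<^sub>M count_space UNIV"
proof (induction k)
  case (Suc k)
  let ?P = "\<Pi>\<^sub>M i\<in>UNIV::nat set. count_space (UNIV :: int set)"
  define F where "F = (\<lambda>(h, s) w. (h @ [(s, \<pi> k h s)], if s \<ge> 0 then s - \<pi> k h s + w else s))"
  have "(\<lambda>\<zeta>. F r (\<zeta> k)) \<in> ?P \<rightarrow>\<^sub>M count_space UNIV" for r
    by (rule measurable_compose[OF measurable_component_singleton]) simp_all
  then have "(\<lambda>\<zeta>. F (run \<pi> x (\<lambda>n. \<zeta> (n - 1)) k) (\<zeta> k)) \<in> ?P \<rightarrow>\<^sub>M count_space UNIV"
    using Suc by (rule measurable_compose_countable)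
  moreover have "run \<pi> x (\<lambda>n. \<zeta> (n - 1)) (Suc k) = F (run \<pi> x (\<lambda>n. \<zeta> (n - 1)) k) (\<zeta> k)" for \<zeta>
    by (simp add: F_def Let_def split: prod.split)
  ultimately show ?case by (simp only:)
qed simp

lemma measurable_dividends:
  "(\<lambda>\<zeta>. dividends \<beta> \<pi> x (\<lambda>n. \<zeta> (n - 1)))
     \<in> borel_measurable (\<Pi>\<^sub>M i\<in>UNIV::nat set. count_space UNIV)"
proof -
  let ?P = "\<Pi>\<^sub>M i\<in>UNIV::nat set. count_space (UNIV :: int set)"
  have 1: "(\<lambda>\<zeta>. f (run \<pi> x (\<lambda>n. \<zeta> (n - 1)) k)) \<in> ?P \<rightarrow>\<^sub>M N"
    if "range f \<subseteq> space N" for f k and N :: "'b measure"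
    using that by (intro measurable_compose[OF measurable_run]) auto
  have 2: "Measurable.pred ?P (\<lambda>\<zeta>. \<forall>j\<in>{..k}. 0 \<le> snd (run \<pi> x (\<lambda>n. \<zeta> (n - 1)) j))" for k
    by (intro pred_intros_finite 1) simp_all
  then have 3: "{\<zeta> \<in> space ?P. \<forall>j\<le>k. 0 \<le> snd (run \<pi> x (\<lambda>n. \<zeta> (n - 1)) j)} \<in> sets ?P" for k
    unfolding pred_def Ball_def atMost_iff by blast
  have 4: "(\<lambda>\<zeta>. ennreal (\<beta> ^ k * real_of_int
      (\<pi> k (fst (run \<pi> x (\<lambda>n. \<zeta> (n - 1)) k)) (snd (run \<pi> x (\<lambda>n. \<zeta> (n - 1)) k)))))
      \<in> borel_measurable ?P" for k
    by (rule 1) simp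
  have 5: "(\<lambda>\<zeta>. if \<forall>j\<le>k. 0 \<le> snd (run \<pi> x (\<lambda>n. \<zeta> (n - 1)) j)
      then ennreal (\<beta> ^ k * real_of_int
        (\<pi> k (fst (run \<pi> x (\<lambda>n. \<zeta> (n - 1)) k)) (snd (run \<pi> x (\<lambda>n. \<zeta> (n - 1)) k))))
      else 0) \<in> borel_measurable ?P" for k
    by (rule measurable_If[OF 4 borel_measurable_const 3])
  show ?thesis
    unfolding dividends_def less_ruin_time_iff state_def action_def
    by (rule borel_measurable_suminf_order) (rule 5)
qed

section \<open>Sums over the increments as expectations\<close>

lemma infsum_int_eq_nn_integral:
  fixes f :: "int \<Rightarrow> ennreal"
  shows "(\<Sum>\<^sub>\<infinity>k\<in>UNIV. f k) = (\<integral>\<^sup>+ k. f k \<partial>count_space UNIV)"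
proof -
  obtain g :: "nat \<Rightarrow> int" where g: "bij_betw g UNIV UNIV"
    using bij_int_decode by (auto simp: bij_def bij_betw_def)
  have "(\<Sum>\<^sub>\<infinity>k\<in>UNIV. f k) = (\<Sum>\<^sub>\<infinity>n\<in>UNIV. f (g n))"
    by (rule infsum_reindex_bij_betw[OF g, symmetric])
  also have "\<dots> = (\<Sum>n. f (g n))"
  proof -
    have "(\<lambda>n. f (g n)) summable_on UNIV" by (rule nonneg_summable_on_complete) simp
    then have "((\<lambda>n. f (g n)) has_sum (\<Sum>\<^sub>\<infinity>n\<in>UNIV. f (g n))) UNIV" by simp
    then show ?thesis by (intro sums_unique has_sum_imp_sums)
  qed
  also have "\<dots> = (\<integral>\<^sup>+ n. f (g n) \<partial>count_space UNIV)"
    by (simp add: nn_integral_count_space_nat)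
  also have "\<dots> = (\<integral>\<^sup>+ k. f k \<partial>count_space UNIV)"
    by (rule nn_integral_bij_count_space[OF g])
  finally show ?thesis .
qed

text \<open>The value of every policy depends on the increments only through their joint law, which
  the assumptions \<open>indep\<close> and \<open>law\<close> determine.\<close>

locale dividend_problem = prob_space M
  for M :: "'w measure" and Z :: "nat \<Rightarrow> 'w \<Rightarrow> int" and q :: "int \<Rightarrow> real" and \<beta> \<gamma> :: real +
  assumes indep: "indep_vars (\<lambda>_. count_space UNIV) Z {1..}"
    and law: "\<And>n k. n \<ge> 1 \<Longrightarrow> measure M {\<omega> \<in> space M. Z n \<omega> = k} = q k"
    and income: "integrable M (\<lambda>\<omega>. real_of_int (max (Z 1 \<omega>) 0))"
    and discount: "0 < \<beta>" "\<beta> < 1"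
    and risk: "0 < \<gamma>" "\<gamma> < 1"
begin

abbreviation "value_of \<equiv> J_policy M Z \<beta> \<gamma>"
abbreviation "best_value \<equiv> J M Z \<beta> \<gamma>"
abbreviation "continuation_value \<equiv> G M Z q \<beta> \<gamma>"
abbreviation "greedy \<equiv> fstar M Z q \<beta> \<gamma>"
abbreviation "greedy_policy \<equiv> pistar M Z q \<beta> \<gamma>"

lemma measurable_Z: "n \<ge> 1 \<Longrightarrow> Z n \<in> M \<rightarrow>\<^sub>M count_space UNIV"
  using indep by (simp add: indep_vars_def)

lemma measurable_fun_Z: "n \<ge> 1 \<Longrightarrow> (\<lambda>\<omega>. F (Z n \<omega>) :: ennreal) \<in> borel_measurable M"
  by (rule measurable_compose[OF measurable_Z]) auto

lemma distr_Z:
  assumes "n \<ge> 1"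
  shows "distr M (count_space UNIV) (Z n) = density (count_space UNIV) (\<lambda>k. ennreal (q k))"
proof (rule measure_eqI_countable[where A = UNIV])
  fix k :: int
  have "Z n -` {k} \<inter> space M = {\<omega> \<in> space M. Z n \<omega> = k}" by auto
  then have "emeasure (distr M (count_space UNIV) (Z n)) {k} = ennreal (q k)"
    using assms by (simp add: emeasure_distr measurable_Z emeasure_eq_measure law)
  also have "\<dots> = emeasure (density (count_space UNIV) (\<lambda>k. ennreal (q k))) {k}"
    by (simp add: emeasure_density nn_integral_count_space_indicator[symmetric]
        nn_integral_count_space_finite)
  finally show "emeasure (distr M (count_space UNIV) (Z n)) {k}
    = emeasure (density (count_space UNIV) (\<lambda>k. ennreal (q k))) {k}" .
qed auto

lemma nn_integral_Z:
  assumes "n \<ge> 1"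
  shows "(\<integral>\<^sup>+ \<omega>. F (Z n \<omega>) \<partial>M) = (\<integral>\<^sup>+ k. ennreal (q k) * F k \<partial>count_space UNIV)"
proof -
  have "(\<integral>\<^sup>+ \<omega>. F (Z n \<omega>) \<partial>M) = (\<integral>\<^sup>+ k. F k \<partial>distr M (count_space UNIV) (Z n))"
    using assms by (simp add: nn_integral_distr measurable_Z)
  then show ?thesis by (simp add: distr_Z[OF assms] nn_integral_density)
qed

lemma continuation_value_eq: "continuation_value x y = (\<integral>\<^sup>+ \<omega>. best_value (x + Z 1 \<omega>) y \<partial>M)"
  unfolding G_def infsum_int_eq_nn_integral
  using nn_integral_Z[of 1 "\<lambda>k. best_value (x + k) y"] by (simp add: mult.commute)

definition mean_income :: real where
  "mean_income = expectation (\<lambda>\<omega>. real_of_int (max (Z 1 \<omega>) 0))"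

lemma mean_income_nonneg: "0 \<le> mean_income"
  by (simp add: mean_income_def)

lemma nn_integral_income:
  assumes "n \<ge> 1"
  shows "(\<integral>\<^sup>+ \<omega>. ennreal (real_of_int (max (Z n \<omega>) 0)) \<partial>M) = ennreal mean_income"
proof -
  have "(\<integral>\<^sup>+ \<omega>. ennreal (real_of_int (max (Z n \<omega>) 0)) \<partial>M)
    = (\<integral>\<^sup>+ \<omega>. ennreal (real_of_int (max (Z 1 \<omega>) 0)) \<partial>M)"
    using nn_integral_Z[OF assms, of "\<lambda>k. ennreal (real_of_int (max k 0))"]
      nn_integral_Z[of 1 "\<lambda>k. ennreal (real_of_int (max k 0))"] by simp
  also have "\<dots> = ennreal mean_income"
    unfolding mean_income_def by (intro nn_integral_eq_integral income) auto
  finally show ?thesis .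
qed

section \<open>Regeneration after the first step\<close>

text \<open>The first increment is independent of the later ones, and the later ones have the same
  joint law as the whole sequence. Hence, after conditioning on the first increment, the remaining
  problem may be driven by a fresh copy of the original sequence. In the sequence space
  this is the invariance of the product measure under prepending an independent coordinate.\<close>

lemma nn_integral_regeneration:
  assumes H: "\<And>k. H k \<in> borel_measurable (\<Pi>\<^sub>M i\<in>UNIV::nat set. count_space (UNIV :: int set))"
  shows "(\<integral>\<^sup>+ \<omega>. H (Z 1 \<omega>) (\<lambda>n. Z (Suc (Suc n)) \<omega>) \<partial>M)
    = (\<integral>\<^sup>+ \<omega>. (\<integral>\<^sup>+ \<omega>'. H (Z 1 \<omega>) (\<lambda>n. Z (Suc n) \<omega>') \<partial>M) \<partial>M)"
proof -
  let ?C = "count_space (UNIV :: int set)"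
  let ?P = "\<Pi>\<^sub>M i\<in>UNIV::nat set. ?C"
  define N where "N = distr M ?C (Z 1)"
  have [simp]: "sets N = UNIV" "space N = UNIV" by (auto simp: N_def)
  have prob_N: "prob_space N" unfolding N_def by (intro prob_space_distr measurable_Z) simp
  interpret seq: sequence_space N
    by (simp add: sequence_space_def product_prob_space_def product_sigma_finite_def
        product_prob_space_axioms_def prob_N prob_space_imp_sigma_finite)
  have setsS [measurable_cong]: "sets seq.S = sets ?P" by (intro sets_PiM_cong) (auto simp: N_def)
  have mZ: "(\<lambda>\<omega> n. Z (Suc n) \<omega>) \<in> M \<rightarrow>\<^sub>M ?P"
    by (rule measurable_PiM_single') (auto intro: measurable_Z)
  have joint: "distr M ?P (\<lambda>\<omega> n. Z (Suc n) \<omega>) = seq.S"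
  proof -
    let ?K = "\<Pi>\<^sub>M i\<in>{1::nat..}. ?C"
    let ?L = "\<lambda>i. distr M ?C (Z i)"
    (* the hypothesis indexes the increments from 1, the sequence space from 0:
       pass through the product over {1..} and reindex along the successor *)
    have N_eq: "?L i = N" if "i \<in> {1..}" for i
      using distr_Z[of i] distr_Z[of 1] that by (simp add: N_def)
    have K: "distr M ?K (\<lambda>\<omega>. \<lambda>i\<in>{1..}. Z i \<omega>) = (\<Pi>\<^sub>M i\<in>{1..}. ?L i)"
      using indep by (subst (asm) indep_vars_iff_distr_eq_PiM') (auto intro: measurable_Z)
    have mK: "(\<lambda>\<omega>. \<lambda>i\<in>{1..}. Z i \<omega>) \<in> M \<rightarrow>\<^sub>M ?K"
      by (intro measurable_restrict measurable_Z) simp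
    have mS: "(\<lambda>\<zeta>. \<lambda>n\<in>UNIV. \<zeta> (Suc n)) \<in> ?K \<rightarrow>\<^sub>M ?P"
      by (intro measurable_restrict measurable_component_singleton) simp
    have "distr M ?P (\<lambda>\<omega> n. Z (Suc n) \<omega>)
        = distr (distr M ?K (\<lambda>\<omega>. \<lambda>i\<in>{1..}. Z i \<omega>)) ?P (\<lambda>\<zeta>. \<lambda>n\<in>UNIV. \<zeta> (Suc n))"
      unfolding distr_distr[OF mS mK] by (rule distr_cong) (simp_all add: comp_def restrict_def)
    also have "\<dots> = distr (\<Pi>\<^sub>M i\<in>{1..}. ?L i) (\<Pi>\<^sub>M n\<in>UNIV. ?L (Suc n)) (\<lambda>\<zeta>. \<lambda>n\<in>UNIV. \<zeta> (Suc n))"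
      unfolding K by (intro distr_cong sets_PiM_cong) simp_all
    also have "\<dots> = (\<Pi>\<^sub>M n\<in>UNIV. ?L (Suc n))"
      by (rule distr_PiM_reindex) (auto intro!: prob_space_distr measurable_Z)
    also have "\<dots> = seq.S"
      by (intro PiM_cong N_eq) simp_all
    finally show ?thesis .
  qed
  have HS: "H k \<in> borel_measurable seq.S" for k
    unfolding measurable_cong_sets[OF setsS refl] by (rule H)
  have tail: "(\<lambda>\<zeta> n. \<zeta> (Suc n)) \<in> ?P \<rightarrow>\<^sub>M ?P"
    by (rule measurable_PiM_single') (auto intro: measurable_component_singleton)
  have pair: "(\<lambda>(k, \<zeta>). H k \<zeta>) \<in> borel_measurable (N \<Otimes>\<^sub>M seq.S)"
  proof -
    have "(\<lambda>p. H k (snd p)) \<in> borel_measurable (N \<Otimes>\<^sub>M seq.S)" for k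
      by (rule measurable_compose[OF measurable_snd HS])
    moreover have "fst \<in> N \<Otimes>\<^sub>M seq.S \<rightarrow>\<^sub>M ?C"
      using measurable_fst[of N seq.S] by (simp add: N_def)
    ultimately show ?thesis
      using measurable_compose_countable[of "\<lambda>k p. H k (snd p)" "N \<Otimes>\<^sub>M seq.S" borel fst]
      by (simp add: case_prod_beta)
  qed
  have first: "(\<lambda>\<zeta>. \<zeta> 0) \<in> ?P \<rightarrow>\<^sub>M ?C" by (rule measurable_component_singleton) simp
  have comb: "(\<lambda>\<zeta>. H (\<zeta> 0) (\<lambda>n. \<zeta> (Suc n))) \<in> borel_measurable ?P"
    by (rule measurable_compose_countable[OF measurable_compose[OF tail H] first])
  then have comb': "(\<lambda>\<zeta>. H (\<zeta> 0) (\<lambda>n. \<zeta> (Suc n))) \<in> borel_measurable seq.S"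
    unfolding measurable_cong_sets[OF setsS refl] .
  have cons: "(\<lambda>(s, \<zeta>). case_nat s \<zeta>) \<in> N \<Otimes>\<^sub>M seq.S \<rightarrow>\<^sub>M seq.S"
    by measurable
  have "(\<integral>\<^sup>+ \<omega>. H (Z 1 \<omega>) (\<lambda>n. Z (Suc (Suc n)) \<omega>) \<partial>M)
    = (\<integral>\<^sup>+ \<zeta>. H (\<zeta> 0) (\<lambda>n. \<zeta> (Suc n)) \<partial>distr M ?P (\<lambda>\<omega> n. Z (Suc n) \<omega>))"
    by (simp add: nn_integral_distr[OF mZ] comb)
  also have "\<dots> = (\<integral>\<^sup>+ \<zeta>. H (\<zeta> 0) (\<lambda>n. \<zeta> (Suc n))
      \<partial>distr (N \<Otimes>\<^sub>M seq.S) seq.S (\<lambda>(s, \<zeta>). case_nat s \<zeta>))"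
    by (simp add: joint seq.PiM_iter)
  also have "\<dots> = (\<integral>\<^sup>+ p. (\<lambda>(k, \<zeta>). H k \<zeta>) p \<partial>(N \<Otimes>\<^sub>M seq.S))"
    using comb' by (subst nn_integral_distr[OF cons]) (simp_all add: split_beta')
  also have "\<dots> = (\<integral>\<^sup>+ k. (\<integral>\<^sup>+ \<zeta>. H k \<zeta> \<partial>seq.S) \<partial>N)"
    using seq.P.nn_integral_fst[OF pair] by simp
  also have "\<dots> = (\<integral>\<^sup>+ k. (\<integral>\<^sup>+ \<omega>'. H k (\<lambda>n. Z (Suc n) \<omega>') \<partial>M) \<partial>N)"
    by (simp add: joint[symmetric] nn_integral_distr[OF mZ] H)
  also have "\<dots> = (\<integral>\<^sup>+ \<omega>. (\<integral>\<^sup>+ \<omega>'. H (Z 1 \<omega>) (\<lambda>n. Z (Suc n) \<omega>') \<partial>M) \<partial>M)"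
    unfolding N_def by (subst nn_integral_distr) (auto intro: measurable_Z)
  finally show ?thesis .
qed

lemma value_of_ruined: "x < 0 \<Longrightarrow> 0 \<le> y \<Longrightarrow> value_of \<pi> x y = ennreal (y powr \<gamma>)"
  by (simp add: J_policy_def dividends_ruined ennreal_power_ennreal emeasure_space_1)

text \<open>The sum of \<open>y\<close> and the dividends equals \<open>\<beta>\<close> times the dividends of the continuation plus
  \<open>(a + y) / \<beta>\<close>. Homogeneity of the power moves \<open>\<beta>\<close> out of the expectation, and regeneration identifies
  the inner expectation as a value of the original problem.\<close>

lemma value_of_first_step:
  assumes "0 \<le> x" "0 \<le> y" "a = \<pi> 0 [] x" "0 \<le> a"
  shows "value_of \<pi> x y = ennreal (\<beta> powr \<gamma>) *
    (\<integral>\<^sup>+ \<omega>. value_of (continuation \<pi> (x, a)) (x - a + Z 1 \<omega>) ((real_of_int a + y) / \<beta>) \<partial>M)"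
proof -
  let ?\<pi> = "continuation \<pi> (x, a)" and ?y = "(real_of_int a + y) / \<beta>"
  define H where "H k \<zeta> = ennreal_power (dividends \<beta> ?\<pi> (x - a + k) (\<lambda>n. \<zeta> (n - 1)) + ennreal ?y) \<gamma>"
    for k and \<zeta> :: "nat \<Rightarrow> int"
  have H: "H k \<in> borel_measurable (\<Pi>\<^sub>M i\<in>UNIV::nat set. count_space (UNIV :: int set))" for k
    unfolding H_def
    by (rule measurable_compose[OF _ measurable_ennreal_power])
       (intro borel_measurable_add measurable_dividends borel_measurable_const)
  (* brings the increments into the shifted form that H expects; only index 0 is affected *)
  have shift: "dividends \<beta> p s (\<lambda>n. Z (f n) \<omega>) = dividends \<beta> p s (\<lambda>n. Z (f (Suc (n - 1))) \<omega>)"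
    for p s f \<omega> by (rule dividends_cong) simp
  have payoff: "ennreal_power (dividends \<beta> \<pi> x (\<lambda>n. Z n \<omega>) + ennreal y) \<gamma>
    = ennreal (\<beta> powr \<gamma>) * H (Z 1 \<omega>) (\<lambda>n. Z (Suc (Suc n)) \<omega>)" for \<omega>
  proof -
    have "dividends \<beta> \<pi> x (\<lambda>n. Z n \<omega>) + ennreal y
      = ennreal \<beta> * (dividends \<beta> ?\<pi> (x - a + Z 1 \<omega>) (\<lambda>n. Z (Suc n) \<omega>) + ennreal ?y)"
    proof -
      have "ennreal \<beta> * ennreal ?y = ennreal (real_of_int a) + ennreal y"
        using assms discount by (simp add: ennreal_mult[symmetric] ennreal_plus[symmetric] del: ennreal_plus)
      then show ?thesis
        using dividends_first_step[of \<beta> x a \<pi> "\<lambda>n. Z n \<omega>"] assms discount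
        by (simp add: distrib_left ac_simps)
    qed
    then show ?thesis
      using discount shift[of ?\<pi> "x - a + Z 1 \<omega>" Suc] by (simp add: ennreal_power_cmult H_def)
  qed
  have "value_of \<pi> x y
    = ennreal (\<beta> powr \<gamma>) * (\<integral>\<^sup>+ \<omega>. H (Z 1 \<omega>) (\<lambda>n. Z (Suc (Suc n)) \<omega>) \<partial>M)"
  proof -
    have "(\<lambda>\<omega>. H (Z 1 \<omega>) (\<lambda>n. Z (Suc (Suc n)) \<omega>)) \<in> borel_measurable M"
    proof (rule measurable_compose_countable[OF _ measurable_Z])
      show "(\<lambda>\<omega>. H k (\<lambda>n. Z (Suc (Suc n)) \<omega>)) \<in> borel_measurable M" for k
        by (rule measurable_compose[OF measurable_PiM_single' H]) (auto intro: measurable_Z)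
    qed simp
    then show ?thesis by (simp only: J_policy_def payoff nn_integral_cmult)
  qed
  also have "\<dots> = ennreal (\<beta> powr \<gamma>) *
      (\<integral>\<^sup>+ \<omega>. (\<integral>\<^sup>+ \<omega>'. H (Z 1 \<omega>) (\<lambda>n. Z (Suc n) \<omega>') \<partial>M) \<partial>M)"
    by (simp only: nn_integral_regeneration[of H, OF H])
  finally have unfolded: "value_of \<pi> x y = ennreal (\<beta> powr \<gamma>) *
      (\<integral>\<^sup>+ \<omega>. (\<integral>\<^sup>+ \<omega>'. H (Z 1 \<omega>) (\<lambda>n. Z (Suc n) \<omega>') \<partial>M) \<partial>M)" .
  have "(\<integral>\<^sup>+ \<omega>'. H k (\<lambda>n. Z (Suc n) \<omega>') \<partial>M) = value_of ?\<pi> (x - a + k) ?y" for k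
    unfolding H_def J_policy_def shift[of ?\<pi> "x - a + k" "\<lambda>n. n", symmetric] ..
  with unfolded show ?thesis by (simp only:)
qed

section \<open>Bellman relations\<close>

lemma greedy_maximal:
  assumes "0 \<le> x" "b \<in> A x"
  shows "ennreal (\<beta> powr \<gamma>) * continuation_value (x - b) ((real_of_int b + y) / \<beta>)
    \<le> ennreal (\<beta> powr \<gamma>) * continuation_value (x - greedy x y) ((real_of_int (greedy x y) + y) / \<beta>)"
proof -
  define v where "v = (\<lambda>a. ennreal (\<beta> powr \<gamma>) * continuation_value (x - a) ((real_of_int a + y) / \<beta>))"
  define S where "S = {a \<in> A x. \<forall>b\<in>A x. v b \<le> v a}"
  have fin: "finite (A x)" using assms by (simp add: A_def)
  have "Max (v ` A x) \<in> v ` A x" using fin assms by (intro Max_in) auto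
  then obtain a where "a \<in> A x" "v a = Max (v ` A x)" by auto
  then have "a \<in> S" using fin by (auto simp: S_def)
  then have "Max S \<in> S" using fin by (intro Max_in) (auto simp: S_def)
  moreover have "greedy x y = Max S" using assms by (simp add: fstar_def S_def v_def Let_def)
  ultimately show ?thesis using assms by (auto simp: S_def v_def)
qed

lemma greedy_bounds: "0 \<le> x \<Longrightarrow> 0 \<le> greedy x y \<and> greedy x y \<le> x"
  using fstar_in_A[of M Z q \<beta> \<gamma> x y] by (simp add: A_def)

text \<open>One half of the Bellman equation: each policy is compared with the best continuation
  after its own first action, and that first action with the maximiser.\<close>

lemma best_value_le_greedy:
  assumes "0 \<le> x" "0 \<le> y"
  shows "best_value x y
    \<le> ennreal (\<beta> powr \<gamma>) * continuation_value (x - greedy x y) ((real_of_int (greedy x y) + y) / \<beta>)"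
  unfolding J_def
proof (rule SUP_least)
  fix \<pi> assume \<pi>: "\<pi> \<in> policies"
  define a where "a = \<pi> 0 [] x"
  have a: "a \<in> A x" using policy_action_in_A[OF \<pi>, of "[]" x] by (simp add: a_def)
  then have "0 \<le> a" using assms by (simp add: A_def)
  have "continuation \<pi> (x, a) \<in> policies"
    using \<pi> a by (intro continuation_in_policies) (auto simp: D_def)
  then have "value_of (continuation \<pi> (x, a)) s t \<le> best_value s t" for s t
    unfolding J_def by (intro SUP_upper)
  then have "value_of \<pi> x y \<le> ennreal (\<beta> powr \<gamma>) *
      (\<integral>\<^sup>+ \<omega>. best_value (x - a + Z 1 \<omega>) ((real_of_int a + y) / \<beta>) \<partial>M)"
    using value_of_first_step[of x y a \<pi>] assms \<open>0 \<le> a\<close> a_def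
    by (simp add: mult_left_mono nn_integral_mono)
  also have "\<dots> = ennreal (\<beta> powr \<gamma>) * continuation_value (x - a) ((real_of_int a + y) / \<beta>)"
    by (simp add: continuation_value_eq)
  also note greedy_maximal[OF assms(1) a]
  finally show "value_of \<pi> x y \<le> ennreal (\<beta> powr \<gamma>) *
    continuation_value (x - greedy x y) ((real_of_int (greedy x y) + y) / \<beta>)" .
qed

text \<open>Dividing by \<open>\<beta>\<close> in the update of the accumulated payoff is exactly what makes the family of
  generated policies closed under taking continuations.\<close>

lemma continuation_greedy_policy:
  "continuation (greedy_policy y) (x, a) = greedy_policy ((real_of_int (greedy x y) + y) / \<beta>)"
  by (simp add: continuation_def pistar_def add.commute)

lemma greedy_policy_first_step:
  assumes "0 \<le> x" "0 \<le> y"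
  shows "value_of (greedy_policy y) x y = ennreal (\<beta> powr \<gamma>) *
    (\<integral>\<^sup>+ \<omega>. value_of (greedy_policy ((real_of_int (greedy x y) + y) / \<beta>))
        (x - greedy x y + Z 1 \<omega>) ((real_of_int (greedy x y) + y) / \<beta>) \<partial>M)"
  using value_of_first_step[of x y "greedy x y" "greedy_policy y"] assms greedy_bounds[of x y]
  by (simp add: continuation_greedy_policy) (simp add: pistar_def)

section \<open>The gap between the best and the greedy value\<close>

definition income_bound :: real where
  "income_bound = (\<Sum>k. \<beta> ^ k * (real k * mean_income))"

text \<open>An upper bound for the excess of the best value over the value of the generated policy after
  \<open>n\<close> Bellman steps. The coefficient \<open>1 / (1 - \<beta>)\<close> and \<open>income_bound\<close> come from summing
  \<open>\<beta> ^ k * (x + k * mean_income)\<close> over \<open>k\<close>; the term \<open>1\<close> comes from the affine bound on the utility.\<close>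

definition gap :: "nat \<Rightarrow> int \<Rightarrow> real" where
  "gap n x = (\<beta> powr \<gamma>) ^ n *
    (1 + income_bound + (real_of_int (max x 0) + real n * mean_income) / (1 - \<beta>))"

lemma summable_income: "summable (\<lambda>k. \<beta> ^ k * (real k * mean_income))"
proof -
  have "summable (\<lambda>n. of_nat (Suc n) * \<beta> ^ n - \<beta> ^ n)"
    using discount geometric_deriv_sums[of \<beta>]
    by (intro summable_diff summable_geometric) (auto simp: sums_iff)
  then have "summable (\<lambda>n. (of_nat (Suc n) * \<beta> ^ n - \<beta> ^ n) * mean_income)"
    by (rule summable_mult2)
  then show ?thesis by (simp add: algebra_simps)
qed

lemma income_bound_nonneg: "0 \<le> income_bound"
  unfolding income_bound_def
  using summable_income discount mean_income_nonneg by (intro suminf_nonneg) auto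

lemma gap_nonneg: "0 \<le> gap n x"
  using discount mean_income_nonneg income_bound_nonneg by (simp add: gap_def)

lemma nn_integral_dividends_le:
  assumes "\<pi> \<in> policies"
  shows "(\<integral>\<^sup>+ \<omega>. dividends \<beta> \<pi> x (\<lambda>n. Z n \<omega>) \<partial>M)
    \<le> ennreal (real_of_int (max x 0) / (1 - \<beta>) + income_bound)"
proof -
  let ?x = "real_of_int (max x 0)"
  have increment: "(\<lambda>\<omega>. ennreal (real_of_int (max (Z i \<omega>) 0))) \<in> borel_measurable M"
    if "i \<in> {1..k}" for i k :: nat
    using that measurable_fun_Z[of i "\<lambda>z. ennreal (real_of_int (max z 0))"] by simp
  have total: "(\<lambda>\<omega>. \<Sum>i=1..k. ennreal (real_of_int (max (Z i \<omega>) 0))) \<in> borel_measurable M" for k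
    by (intro borel_measurable_sum increment)
  have "(\<integral>\<^sup>+ \<omega>. dividends \<beta> \<pi> x (\<lambda>n. Z n \<omega>) \<partial>M)
    \<le> (\<integral>\<^sup>+ \<omega>. (\<Sum>k. ennreal (\<beta> ^ k) *
        (ennreal ?x + (\<Sum>i=1..k. ennreal (real_of_int (max (Z i \<omega>) 0))))) \<partial>M)"
    using assms discount by (intro nn_integral_mono dividends_le_discounted_income)
  also have "\<dots> = (\<Sum>k. \<integral>\<^sup>+ \<omega>. ennreal (\<beta> ^ k) *
        (ennreal ?x + (\<Sum>i=1..k. ennreal (real_of_int (max (Z i \<omega>) 0)))) \<partial>M)"
    by (intro nn_integral_suminf borel_measurable_times_ennreal borel_measurable_add total
        borel_measurable_const)
  also have "\<dots> = (\<Sum>k. ennreal (\<beta> ^ k) * (ennreal ?x + of_nat k * ennreal mean_income))"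
  proof (intro suminf_cong)
    fix k
    have "(\<integral>\<^sup>+ \<omega>. (\<Sum>i=1..k. ennreal (real_of_int (max (Z i \<omega>) 0))) \<partial>M)
      = (\<Sum>i=1..k. ennreal mean_income)"
    proof -
      have "(\<integral>\<^sup>+ \<omega>. (\<Sum>i=1..k. ennreal (real_of_int (max (Z i \<omega>) 0))) \<partial>M)
        = (\<Sum>i=1..k. \<integral>\<^sup>+ \<omega>. ennreal (real_of_int (max (Z i \<omega>) 0)) \<partial>M)"
        by (rule nn_integral_sum[OF increment])
      also have "\<dots> = (\<Sum>i=1..k. ennreal mean_income)"
        by (intro sum.cong refl nn_integral_income) simp
      finally show ?thesis .
    qed
    then show "(\<integral>\<^sup>+ \<omega>. ennreal (\<beta> ^ k) *
        (ennreal ?x + (\<Sum>i=1..k. ennreal (real_of_int (max (Z i \<omega>) 0)))) \<partial>M)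
      = ennreal (\<beta> ^ k) * (ennreal ?x + of_nat k * ennreal mean_income)"
      using total[of k]
      by (subst nn_integral_cmult, simp only: borel_measurable_add borel_measurable_const)
         (subst nn_integral_add, simp_all add: emeasure_space_1 del: sum_ennreal)
  qed
  also have "\<dots> = (\<Sum>k. ennreal (\<beta> ^ k * ?x + \<beta> ^ k * (real k * mean_income)))"
    using discount mean_income_nonneg
    by (intro suminf_cong) (simp add: distrib_left ennreal_mult ennreal_of_nat_eq_real_of_nat)
  also have "\<dots> = ennreal (\<Sum>k. \<beta> ^ k * ?x + \<beta> ^ k * (real k * mean_income))"
    using discount mean_income_nonneg
    by (intro suminf_ennreal2 summable_add summable_mult2 summable_geometric summable_income)
       auto
  also have "(\<Sum>k. \<beta> ^ k * ?x + \<beta> ^ k * (real k * mean_income)) = ?x / (1 - \<beta>) + income_bound"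
    using discount unfolding income_bound_def
    by (subst suminf_add[symmetric])
       (auto intro!: summable_income summable_mult2 summable_geometric
         simp: suminf_mult2[symmetric] suminf_geometric)
  finally show ?thesis .
qed

text \<open>The crude bound from which the iteration starts; what matters is that \<open>gap 0 x\<close> does not depend
  on \<open>y\<close>, because the accumulated payoffs grow like \<open>\<beta>\<close> to the power \<open>- n\<close> along the iteration.\<close>

lemma best_value_le_linear:
  assumes "0 \<le> y"
  shows "best_value x y \<le> ennreal (y powr \<gamma>) + ennreal (gap 0 x)"
  unfolding J_def
proof (rule SUP_least)
  fix \<pi> assume \<pi>: "\<pi> \<in> policies"
  let ?d = "\<lambda>\<omega>. dividends \<beta> \<pi> x (\<lambda>n. Z n \<omega>)"
  have "(\<lambda>\<omega>. dividends \<beta> \<pi> x (\<lambda>n. Z (Suc (n - 1)) \<omega>)) \<in> borel_measurable M"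
    by (rule measurable_compose[OF measurable_PiM_single' measurable_dividends])
       (auto intro: measurable_Z)
  moreover have "dividends \<beta> \<pi> x (\<lambda>n. Z (Suc (n - 1)) \<omega>) = ?d \<omega>" for \<omega>
    by (rule dividends_cong) simp
  ultimately have m: "?d \<in> borel_measurable M" by simp
  have "value_of \<pi> x y \<le> (\<integral>\<^sup>+ \<omega>. 1 + ?d \<omega> + ennreal (y powr \<gamma>) \<partial>M)"
    unfolding J_policy_def using risk assms by (intro nn_integral_mono ennreal_power_add_le)
  also have "\<dots> = 1 + (\<integral>\<^sup>+ \<omega>. ?d \<omega> \<partial>M) + ennreal (y powr \<gamma>)"
    using m by (simp add: nn_integral_add emeasure_space_1)
  also have "\<dots> \<le> 1 + ennreal (real_of_int (max x 0) / (1 - \<beta>) + income_bound) + ennreal (y powr \<gamma>)"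
    by (intro add_mono nn_integral_dividends_le \<pi> order_refl)
  also have "\<dots> = ennreal (y powr \<gamma>) + ennreal (gap 0 x)"
    using discount income_bound_nonneg
    by (simp add: gap_def ennreal_plus[symmetric] ennreal_1[symmetric] add_ac
        del: ennreal_plus ennreal_1)
  finally show "value_of \<pi> x y \<le> ennreal (y powr \<gamma>) + ennreal (gap 0 x)" .
qed

text \<open>A step can increase the expected positive part of the surplus by at most \<open>mean_income\<close>, which is
  accounted for by the term \<open>n * mean_income\<close>, and it contributes a discount factor.\<close>

lemma nn_integral_gap_le:
  assumes "0 \<le> a" "a \<le> x"
  shows "ennreal (\<beta> powr \<gamma>) * (\<integral>\<^sup>+ \<omega>. ennreal (gap n (x - a + Z 1 \<omega>)) \<partial>M) \<le> ennreal (gap (Suc n) x)"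
proof -
  define c where "c = (\<beta> powr \<gamma>) ^ n / (1 - \<beta>)"
  have c: "0 \<le> c" using discount by (simp add: c_def)
  have "gap n (x - a + z) \<le> gap n x + c * real_of_int (max z 0)" for z
  proof -
    have "real_of_int (max (x - a + z) 0) \<le> real_of_int (max x 0) + real_of_int (max z 0)"
      using assms by simp
    then have "c * real_of_int (max (x - a + z) 0) \<le> c * (real_of_int (max x 0) + real_of_int (max z 0))"
      using c by (rule mult_left_mono)
    then show ?thesis
      by (simp add: gap_def c_def algebra_simps add_divide_distrib)
  qed
  then have "(\<integral>\<^sup>+ \<omega>. ennreal (gap n (x - a + Z 1 \<omega>)) \<partial>M)
    \<le> (\<integral>\<^sup>+ \<omega>. ennreal (gap n x) + ennreal c * ennreal (real_of_int (max (Z 1 \<omega>) 0)) \<partial>M)"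
    using gap_nonneg c
    by (intro nn_integral_mono) (simp add: ennreal_mult[symmetric] ennreal_plus[symmetric] del: ennreal_plus)
  also have "\<dots> = ennreal (gap n x) + ennreal c * ennreal mean_income"
    using nn_integral_income[of 1] measurable_fun_Z[of 1 "\<lambda>k. ennreal (real_of_int (max k 0))"]
    by (simp add: nn_integral_add nn_integral_cmult emeasure_space_1)
  also have "\<dots> = ennreal (gap n x + c * mean_income)"
    using c mean_income_nonneg gap_nonneg by (simp add: ennreal_mult)
  finally have "ennreal (\<beta> powr \<gamma>) * (\<integral>\<^sup>+ \<omega>. ennreal (gap n (x - a + Z 1 \<omega>)) \<partial>M)
    \<le> ennreal (\<beta> powr \<gamma>) * ennreal (gap n x + c * mean_income)"
    by (rule mult_left_mono) simp
  also have "\<dots> = ennreal ((\<beta> powr \<gamma>) * (gap n x + c * mean_income))"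
    using c mean_income_nonneg gap_nonneg by (simp add: ennreal_mult)
  also have "(\<beta> powr \<gamma>) * (gap n x + c * mean_income) = gap (Suc n) x"
  proof -
    have "(real_of_int (max x 0) + real (Suc n) * mean_income) / (1 - \<beta>)
      = (real_of_int (max x 0) + real n * mean_income) / (1 - \<beta>) + mean_income / (1 - \<beta>)"
      by (simp add: add_divide_distrib[symmetric] algebra_simps)
    then show ?thesis by (simp add: gap_def c_def distrib_left mult.assoc)
  qed
  finally show ?thesis .
qed

text \<open>Both values satisfy the same one-step relation along the maximiser, as an inequality for the
  best value and as an equality for the generated policy, so a bound on the excess after the
  step, for all states and accumulated payoffs, yields a smaller one before it. At the start the
  value of the generated policy is at least \<open>y powr \<gamma>\<close>, since dividends are nonnegative.\<close>

lemma best_value_le_greedy_plus_gap: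
  assumes "0 \<le> y"
  shows "best_value x y \<le> value_of (greedy_policy y) x y + ennreal (gap n x)"
  using assms
proof (induction n arbitrary: x y)
  case 0
  have "ennreal (y powr \<gamma>) = (\<integral>\<^sup>+ \<omega>. ennreal_power (ennreal y) \<gamma> \<partial>M)"
    using 0 by (simp add: ennreal_power_ennreal emeasure_space_1)
  also have "\<dots> \<le> value_of (greedy_policy y) x y"
    unfolding J_policy_def using risk by (intro nn_integral_mono ennreal_power_mono) auto
  finally show ?case
    using best_value_le_linear[OF 0, of x] by (meson add_right_mono order_trans)
next
  case (Suc n)
  show ?case
  proof (cases "0 \<le> x")
    case False
    then have "best_value x y = ennreal (y powr \<gamma>)"
      using Suc.prems pistar_in_policies[of M Z q \<beta> \<gamma> y] by (auto simp: J_def value_of_ruined intro!: cSUP_const)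
    then show ?thesis using False Suc.prems by (simp add: value_of_ruined)
  next
    case True
    define a where "a = greedy x y"
    define y' where "y' = (real_of_int a + y) / \<beta>"
    have a: "0 \<le> a" "a \<le> x" using greedy_bounds[OF True] by (auto simp: a_def)
    have y': "0 \<le> y'" using a Suc.prems discount by (simp add: y'_def)
    have "best_value x y
      \<le> ennreal (\<beta> powr \<gamma>) * (\<integral>\<^sup>+ \<omega>. best_value (x - a + Z 1 \<omega>) y' \<partial>M)"
      using best_value_le_greedy[OF True Suc.prems]
      by (simp add: continuation_value_eq a_def y'_def)
    also have "\<dots> \<le> ennreal (\<beta> powr \<gamma>) *
       (\<integral>\<^sup>+ \<omega>. value_of (greedy_policy y') (x - a + Z 1 \<omega>) y' + ennreal (gap n (x - a + Z 1 \<omega>)) \<partial>M)"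
      by (intro mult_left_mono nn_integral_mono Suc.IH y') simp
    also have "\<dots> = value_of (greedy_policy y) x y
       + ennreal (\<beta> powr \<gamma>) * (\<integral>\<^sup>+ \<omega>. ennreal (gap n (x - a + Z 1 \<omega>)) \<partial>M)"
      using greedy_policy_first_step[OF True Suc.prems]
        measurable_fun_Z[of 1 "\<lambda>k. value_of (greedy_policy y') (x - a + k) y'"]
        measurable_fun_Z[of 1 "\<lambda>k. ennreal (gap n (x - a + k))"]
      by (simp add: nn_integral_add distrib_left a_def y'_def)
    also have "\<dots> \<le> value_of (greedy_policy y) x y + ennreal (gap (Suc n) x)"
      by (intro add_left_mono nn_integral_gap_le a)
    finally show ?thesis .
  qed
qed

lemma gap_tendsto_0: "(\<lambda>n. gap n x) \<longlonglongrightarrow> 0"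
proof -
  define r where "r = \<beta> powr \<gamma>"
  have r: "0 \<le> r" "r < 1" using discount risk powr_less_mono2[of \<gamma> \<beta> 1] by (simp_all add: r_def)
  have 1: "(\<lambda>n. r ^ n) \<longlonglongrightarrow> 0" using r by (intro LIMSEQ_realpow_zero)
  have 2: "(\<lambda>n. real n * r ^ n) \<longlonglongrightarrow> 0" using r by (intro powser_times_n_limit_0) auto
  have "(\<lambda>n. r ^ n * (1 + income_bound + real_of_int (max x 0) / (1 - \<beta>))
      + real n * r ^ n * (mean_income / (1 - \<beta>))) \<longlonglongrightarrow> 0"
    by (intro tendsto_add_zero tendsto_mult_left_zero 1 2)
  then show ?thesis by (simp add: gap_def r_def algebra_simps add_divide_distrib)
qed

theorem greedy_policy_optimal:
  assumes "0 \<le> y"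
  shows "best_value x y = value_of (greedy_policy y) x y"
proof (rule antisym)
  have "(\<lambda>n. value_of (greedy_policy y) x y + ennreal (gap n x))
      \<longlonglongrightarrow> value_of (greedy_policy y) x y + ennreal 0"
    by (intro tendsto_add tendsto_const tendsto_ennrealI gap_tendsto_0)
  then show "best_value x y \<le> value_of (greedy_policy y) x y"
    using best_value_le_greedy_plus_gap[OF assms] by (intro LIMSEQ_le_const) auto
  show "value_of (greedy_policy y) x y \<le> best_value x y"
    unfolding J_def by (intro SUP_upper pistar_in_policies)
qed

end

theorem theorem4p10:
  fixes M :: "'w measure" and Z :: "nat \<Rightarrow> 'w \<Rightarrow> int" and q :: "int \<Rightarrow> real"
    and \<beta> \<gamma> :: real and x :: int and y :: real
  assumes "prob_space M"
    and "prob_space.indep_vars M (\<lambda>_. count_space UNIV) Z {1..}"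
    and "\<And>n k. n \<ge> 1 \<Longrightarrow> measure M {\<omega> \<in> space M. Z n \<omega> = k} = q k"
    and "integrable M (\<lambda>\<omega>. real_of_int (max (Z 1 \<omega>) 0))"
    and "measure M {\<omega> \<in> space M. Z 1 \<omega> < 0} > 0"
    and "0 < \<beta>" and "\<beta> < 1"
    and "0 < \<gamma>" and "\<gamma> < 1"
    and "y \<ge> 0"
  shows "J M Z \<beta> \<gamma> x y = J_policy M Z \<beta> \<gamma> (pistar M Z q \<beta> \<gamma> y) x y"
proof -
  interpret dividend_problem M Z q \<beta> \<gamma>
    using assms by (simp add: dividend_problem_def dividend_problem_axioms_def)
  show ?thesis using assms by (intro greedy_policy_optimal)
qed

end
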